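(* Let $\mathcal{C}_1,\mathcal{C}_2\subset\mathbb{R}^3$ be rational curves with proper parametrizations $\boldsymbol{x}_1(t),\boldsymbol{x}_2(s)$ with coefficients in $\mathbb{Q}$, where $\mathcal{C}_2$ is contained in a plane $\Pi$, satisfying the standing assumptions in the context. Let $\tilde{\mathbf a}\in\mathbb{P}^3_{\mathbb{R}}$ satisfy $\mathcal{C}_2=\mathcal{P}_{\tilde{\mathbf a}}(\mathcal{C}_1)$. If $\tilde{\mathbf a}$ has rational coordinates (i.e. it has projective coordinates in $\mathbb{Q}$), then the polynomial $G(t,s)$ associated with $\mathcal{P}_{\tilde{\mathbf a}}$ has rational coefficients (up to multiplication by a nonzero constant).
   Context: Standing assumptions. $\mathcal{C}_1\neq\mathcal{C}_2$ are rational curves in $\mathbb{R}^3$ with parametrizations $\boldsymbol{x}_j(t)=(x_j(t),y_j(t),z_j(t))$, $j=1,2$, whose components are rational functions with coefficients in $\mathbb{Q}$. The parametrizations are proper: birational onto the curve, equivalently injective except for finitely many parameter values. $\mathcal{C}_2$ is contained in a plane $\Pi$; $\mathcal{C}_1$ is not necessarily planar; $\mathcal{C}_1$ and $\mathcal{C}_2$ are not both contained in one common plane; neither $\mathcal{C}_1$ nor $\mathcal{C}_2$ is a straight line. The parameter may be taken complex, and each curve is identified with its projective closure in $\mathbb{P}^3_{\mathbb{C}}$. Projections. For a real projective point $\tilde{\mathbf a}=[\tilde a_1:\tilde a_2:\tilde a_3:\tilde a_4]\in\mathbb{P}^3_{\mathbb{R}}$ (the eye point) not lying on the projective closure of $\Pi$,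 $\mathcal{P}_{\tilde{\mathbf a}}$ is the projection onto $\Pi$ from $\tilde{\mathbf a}$: it maps a point $\boldsymbol p\ne\tilde{\mathbf a}$ of $\mathbb{P}^3_{\mathbb{C}}$ to the intersection of (the projective closure of) $\Pi$ with the line through $\tilde{\mathbf a}$ and $\boldsymbol p$. "$\mathcal{C}_2=\mathcal{P}_{\tilde{\mathbf a}}(\mathcal{C}_1)$" means that every (complex projective) point of $\mathcal{C}_2$ is the projection of some (complex projective) point of $\mathcal{C}_1$. Associated function and polynomial. If $\mathcal{C}_2=\mathcal{P}_{\tilde{\mathbf a}}(\mathcal{C}_1)$, the rational function associated with $\mathcal{P}_{\tilde{\mathbf a}}$ is $\psi=\boldsymbol{x}_2^{-1}\circ\mathcal{P}_{\tilde{\mathbf a}}\circ\boldsymbol{x}_1$, i.e. the real rational function $\psi(t)$ with $\mathcal{P}_{\tilde{\mathbf a}}\circ\boldsymbol{x}_1=\boldsymbol{x}_2\circ\psi$. Writing $\psi(t)=p(t)/q(t)$ with $p,q$ coprime polynomials, the polynomial associated with $\psi$, and with $\mathcal{P}_{\tilde{\mathbf a}}$, is $G(t,s)=p(t)-s\,q(t)$, defined up to a nonzero constant factor. *)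

theory Defs
  imports
    "HOL-Analysis.Analysis"
    "HOL-Computational_Algebra.Computational_Algebra"
    "HOL-Computational_Algebra.Field_as_Ring"
begin

section \<open>Rational functions and rational parametrizations\<close>

text \<open>
  The argument \<open>\<iota>\<close> embeds the coefficient field into the field in which a rational
  function is evaluated. Numerator and denominator are the coprime pair supplied by
  \<^const>\<open>quot_of_fract\<close>, so \<open>ratfun_pole\<close> holds exactly at the genuine poles;
  \<open>ratfun_eval\<close> is meaningful only away from them.
\<close>

definition ratfun_pole :: "('k \<Rightarrow> 'f) \<Rightarrow> 'k::field_gcd poly fract \<Rightarrow> 'f::field \<Rightarrow> bool" where
  "ratfun_pole \<iota> r t \<longleftrightarrow> poly (map_poly \<iota> (snd (quot_of_fract r))) t = 0"

definition ratfun_eval :: "('k \<Rightarrow> 'f) \<Rightarrow> 'k::field_gcd poly fract \<Rightarrow> 'f::field \<Rightarrow> 'f" where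
  "ratfun_eval \<iota> r t =
     poly (map_poly \<iota> (fst (quot_of_fract r))) t / poly (map_poly \<iota> (snd (quot_of_fract r))) t"

type_synonym rat_param = "(rat poly fract)^3"

definition param_dom :: "rat_param \<Rightarrow> 'f::field_char_0 set" where
  "param_dom x = {t. \<forall>i. \<not> ratfun_pole of_rat (x $ i) t}"

definition param_at :: "rat_param \<Rightarrow> 'f::field_char_0 \<Rightarrow> 'f^3" where
  "param_at x t = (\<chi> i. ratfun_eval of_rat (x $ i) t)"

text \<open>
  Injectivity is required over the complex parameters. Real injectivity would not
  suffice for birationality: consider \<open>t \<mapsto> (t\<^sup>3, t\<^sup>6, 0)\<close>.
\<close>

definition proper_param :: "rat_param \<Rightarrow> bool" where
  "proper_param x \<longleftrightarrow>
     (\<exists>S. finite S \<and> inj_on (param_at x :: complex \<Rightarrow> complex^3) (param_dom x - S))"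

section \<open>Complex projective space\<close>

text \<open>
  A point of projective 3-space is given by a nonzero vector of homogeneous coordinates, the
  affine part being where the fourth coordinate is nonzero. Two such vectors represent
  the same point iff \<open>proj_eq\<close> relates them. A set of projective points is represented by the
  set of all homogeneous coordinate vectors of its members, so that equality and inclusion
  of sets of projective points are equality and inclusion of the representing sets.
\<close>

definition proj_eq :: "'f::field^4 \<Rightarrow> 'f^4 \<Rightarrow> bool" where
  "proj_eq u v \<longleftrightarrow> (\<exists>k. k \<noteq> 0 \<and> u = k *s v)"

definition homog :: "'f::field^3 \<Rightarrow> 'f^4" where
  "homog v = vector [v $ 1, v $ 2, v $ 3, 1]"

definition complexify :: "real^'n \<Rightarrow> complex^'n" where
  "complexify v = (\<chi> i. complex_of_real (v $ i))"

text \<open>The homogeneous form of degree \<open>d\<close> in four variables with coefficient family \<open>c\<close>.\<close>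

definition form :: "nat \<Rightarrow> ((4 \<Rightarrow> nat) \<Rightarrow> complex) \<Rightarrow> complex^4 \<Rightarrow> complex" where
  "form d c v = (\<Sum>\<alpha>\<in>{\<alpha>. (\<Sum>i\<in>UNIV. \<alpha> i) = d}. c \<alpha> * (\<Prod>i\<in>UNIV. v $ i ^ \<alpha> i))"

lemma finite_exponents_of_degree: "finite {\<alpha> :: 4 \<Rightarrow> nat. (\<Sum>i\<in>UNIV. \<alpha> i) = d}"
proof (rule finite_subset)
  show "{\<alpha> :: 4 \<Rightarrow> nat. (\<Sum>i\<in>UNIV. \<alpha> i) = d} \<subseteq> (UNIV :: 4 set) \<rightarrow>\<^sub>E {..d}"
    by (auto simp: PiE_UNIV_domain intro: member_le_sum)
  show "finite ((UNIV :: 4 set) \<rightarrow>\<^sub>E {..d})"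
    by (intro finite_PiE) auto
qed

text \<open>The Zariski closure in complex projective space of a set of real affine points.\<close>

definition proj_closure :: "(real^3) set \<Rightarrow> (complex^4) set" where
  "proj_closure S =
     {v. v \<noteq> 0 \<and> (\<forall>d c. (\<forall>u\<in>S. form d c (homog (complexify u)) = 0) \<longrightarrow> form d c v = 0)}"

text \<open>
  The image of a parametrization may miss finitely many real points of the curve; passing to
  the closure restores them, so this set depends only on the curve.
\<close>

definition proj_curve :: "rat_param \<Rightarrow> (complex^4) set" where
  "proj_curve x = proj_closure (param_at x ` (param_dom x :: real set))"

section \<open>Projection from an eye point onto a plane\<close>

text \<open>
  \<open>projects_to E a p r\<close>: the point \<open>p\<close> is distinct from \<open>a\<close>, and \<open>r\<close> lies both on the line
  through \<open>a\<close> and \<open>p\<close> and on the closure of \<open>E\<close>. If \<open>a\<close> is not on the closure of the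
  plane \<open>E\<close>, this determines the projective point \<open>r\<close> uniquely.
\<close>

definition projects_to ::
    "(real^3) set \<Rightarrow> real^4 \<Rightarrow> complex^4 \<Rightarrow> complex^4 \<Rightarrow> bool" where
  "projects_to E a p r \<longleftrightarrow>
     \<not> proj_eq p (complexify a) \<and> r \<in> proj_closure E \<and>
     (\<exists>\<alpha> \<beta>. r = \<alpha> *s complexify a + \<beta> *s p)"

definition projects_onto ::
    "(real^3) set \<Rightarrow> real^4 \<Rightarrow> (complex^4) set \<Rightarrow> (complex^4) set \<Rightarrow> bool" where
  "projects_onto E a C1 C2 \<longleftrightarrow> (\<forall>r\<in>C2. \<exists>p\<in>C1. projects_to E a p r)"

definition rational_proj_point :: "real^4 \<Rightarrow> bool" where
  "rational_proj_point a \<longleftrightarrow> (\<exists>k. k \<noteq> 0 \<and> (\<forall>i. k * a $ i \<in> \<rat>))"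

section \<open>The associated rational function and polynomial\<close>

text \<open>
  The identity \<open>P\<^sub>a \<circ> x\<^sub>1 = x\<^sub>2 \<circ> \<psi>\<close> of rational maps: both sides are defined and agree
  at all but finitely many complex parameter values.
\<close>

definition assoc_ratfun ::
    "(real^3) set \<Rightarrow> real^4 \<Rightarrow> rat_param \<Rightarrow> rat_param \<Rightarrow> real poly fract \<Rightarrow> bool" where
  "assoc_ratfun E a x1 x2 \<psi> \<longleftrightarrow>
     finite {t :: complex. \<not> (t \<in> param_dom x1 \<and> \<not> ratfun_pole of_real \<psi> t \<and>
       ratfun_eval of_real \<psi> t \<in> param_dom x2 \<and>
       projects_to E a (homog (param_at x1 t)) (homog (param_at x2 (ratfun_eval of_real \<psi> t))))}"

text \<open>
  \<open>G(t,s) = p(t) - s q(t)\<close> is encoded as a polynomial in \<open>s\<close> with coefficients in \<open>\<real>[t]\<close>.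
\<close>

definition assoc_poly ::
    "(real^3) set \<Rightarrow> real^4 \<Rightarrow> rat_param \<Rightarrow> rat_param \<Rightarrow> real poly poly \<Rightarrow> bool" where
  "assoc_poly E a x1 x2 G \<longleftrightarrow>
     (\<exists>\<psi> p q. assoc_ratfun E a x1 x2 \<psi> \<and> q \<noteq> 0 \<and> coprime p q \<and>
        \<psi> = Fraction_Field.Fract p q \<and> G = [:p, - q:])"

end

theory Submission
  imports Defs
begin

text \<open>
  Let \<open>t\<close> be a rational parameter. The point \<open>x2(s)\<close> lies on the line through \<open>a\<close> and \<open>x1(t)\<close> iff
  certain polynomials in \<open>s\<close> with rational coefficients vanish (Cramer's rule), and then \<open>x2(s)\<close> is
  the projection of \<open>x1(t)\<close>, because \<open>a\<close> is not in the plane. Since \<open>x2\<close> is injective up to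
  finitely many parameters, \<open>s = \<psi>(t)\<close> is, for all but finitely many \<open>t\<close>, an algebraic number with
  no conjugate other than itself, that is, a rational number. The finiteness uses that \<open>\<psi>\<close> is not
  constant: otherwise all of \<open>C1\<close> would lie on one line through \<open>a\<close> and project to a single point.

  So \<open>\<psi> = p/q\<close> takes rational values at infinitely many rational arguments. Scale \<open>p\<close> and \<open>q\<close> so
  that \<open>q\<close> is monic, and apply a \<open>\<rat>\<close>-linear retraction \<open>\<phi>\<close> of the reals onto the rationals to the
  coefficients. Then \<open>\<phi>(p)/\<phi>(q)\<close> has the same values as \<open>p/q\<close> at these arguments, hence
  \<open>\<phi>(p) q = p \<phi>(q)\<close>, and coprimality gives \<open>\<phi>(q) = q\<close> and \<open>\<phi>(p) = p\<close>.
\<close>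

unbundle no Formal_Power_Series.fps_syntax

section \<open>Polynomials under a change of coefficients\<close>

lemma poly_map_poly_add:
  assumes "\<iota> 0 = 0" "\<And>a b. \<iota> (a + b) = \<iota> a + \<iota> b"
  shows "poly (map_poly \<iota> (P + Q)) z = poly (map_poly \<iota> P) z + poly (map_poly \<iota> Q) (z :: 'b::comm_semiring_0)"
proof -
  have "map_poly \<iota> (P + Q) = map_poly \<iota> P + map_poly \<iota> Q"
    by (rule poly_eqI) (simp add: coeff_map_poly assms)
  then show ?thesis by simp
qed

lemma poly_map_poly_mult:
  fixes \<iota> :: "'a::comm_semiring_0 \<Rightarrow> 'b::comm_semiring_0"
  assumes "\<iota> 0 = 0" "\<And>a b. \<iota> (a + b) = \<iota> a + \<iota> b" "\<And>a b. \<iota> (a * b) = \<iota> a * \<iota> b"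
  shows "poly (map_poly \<iota> (P * Q)) z = poly (map_poly \<iota> P) z * poly (map_poly \<iota> Q) z"
proof -
  have smult: "poly (map_poly \<iota> (smult c R)) z = \<iota> c * poly (map_poly \<iota> R) z" for c R
  proof -
    have "map_poly \<iota> (smult c R) = smult (\<iota> c) (map_poly \<iota> R)"
      by (rule poly_eqI) (simp add: coeff_map_poly assms)
    then show ?thesis by simp
  qed
  show ?thesis
    by (induction P)
       (simp_all add: map_poly_pCons assms poly_map_poly_add smult algebra_simps)
qed

abbreviation rat_poly_at :: "rat poly \<Rightarrow> 'f::field_char_0 \<Rightarrow> 'f" where
  "rat_poly_at P z \<equiv> poly (map_poly of_rat P) z"

lemma rat_poly_at_add [simp]: "rat_poly_at (P + Q) z = rat_poly_at P z + rat_poly_at Q z"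
  by (rule poly_map_poly_add) (simp_all add: of_rat_add)

lemma rat_poly_at_mult [simp]: "rat_poly_at (P * Q) z = rat_poly_at P z * rat_poly_at Q z"
  by (rule poly_map_poly_mult) (simp_all add: of_rat_add of_rat_mult)

lemma rat_poly_at_smult [simp]: "rat_poly_at (smult c P) z = of_rat c * rat_poly_at P z"
  using rat_poly_at_mult[of "[:c:]" P z] by (simp add: map_poly_pCons)

lemma rat_poly_at_diff [simp]: "rat_poly_at (P - Q) z = rat_poly_at P z - rat_poly_at Q z"
proof -
  have "P - Q = P + smult (-1) Q" by simp
  then show ?thesis by (simp only: rat_poly_at_add rat_poly_at_smult) simp
qed

lemma rat_poly_at_of_rat: "rat_poly_at P (of_rat t) = of_rat (poly P t)"
  by (induction P) (simp_all add: map_poly_pCons of_rat_add of_rat_mult)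

lemma of_real_of_rat: "complex_of_real (of_rat a) = of_rat a"
  by (cases a) (simp add: of_rat_rat)

lemma rat_poly_at_of_real: "rat_poly_at P (complex_of_real t) = of_real (rat_poly_at P t)"
  by (induction P) (simp_all add: map_poly_pCons of_real_of_rat)

lemma map_poly_of_rat_eq_0_iff [simp]: "map_poly of_rat P = (0 :: 'f::field_char_0 poly) \<longleftrightarrow> P = 0"
  by (simp add: map_poly_eq_0_iff)

lemma degree_map_poly_of_rat [simp]: "degree (map_poly of_rat P :: 'f::field_char_0 poly) = degree P"
  by (simp add: degree_map_poly)

lemma poly_eq_0_if_infinite_roots:
  fixes P :: "'f::idom poly"
  assumes "infinite T" "\<And>t. t \<in> T \<Longrightarrow> poly P t = 0"
  shows "P = 0"
proof (rule ccontr)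
  assume "P \<noteq> 0"
  then have "finite {t. poly P t = 0}" by (rule poly_roots_finite)
  with assms show False by (meson finite_subset mem_Collect_eq subsetI)
qed

section \<open>Conjugates of an algebraic number\<close>

text \<open>The conjugates of \<open>s0\<close> are the complex roots of its minimal polynomial
  \<open>m\<close>. None of them is a root of \<open>N\<close>, so \<open>sole\<close> applies to
  each and \<open>s0\<close> is the only root. It is a simple root, hence \<open>m\<close> has
  degree 1.\<close>

lemma rational_if_sole_conjugate:
  fixes s0 :: complex
  assumes alg: "F0 \<noteq> 0" "rat_poly_at F0 s0 = 0"
    and N: "rat_poly_at N s0 \<noteq> 0"
    and sole: "\<And>s. (\<And>F. rat_poly_at F s0 = 0 \<Longrightarrow> rat_poly_at F s = 0) \<Longrightarrow> rat_poly_at N s \<noteq> 0 \<Longrightarrow> s = s0"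
  shows "\<exists>r. s0 = of_rat r"
proof -
  obtain m where m: "m \<noteq> 0" "rat_poly_at m s0 = 0"
    and least: "\<And>F. F \<noteq> 0 \<Longrightarrow> rat_poly_at F s0 = 0 \<Longrightarrow> degree m \<le> degree F"
    using ex_has_least_nat[of "\<lambda>F. F \<noteq> 0 \<and> rat_poly_at F s0 = 0" F0 degree] alg by metis
  \<comment> \<open>\<open>m\<close> has least degree among the nonzero rational polynomials
    vanishing at \<open>s0\<close>, so the remainder of \<open>F\<close> modulo \<open>m\<close> is
    zero.\<close>
  have dvd: "m dvd F" if "rat_poly_at F s0 = 0" for F
  proof -
    have "F = m * (F div m) + F mod m" by simp
    then have "rat_poly_at F s0 = rat_poly_at m s0 * rat_poly_at (F div m) s0 + rat_poly_at (F mod m) s0"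
      by (simp flip: rat_poly_at_add rat_poly_at_mult)
    then have "rat_poly_at (F mod m) s0 = 0" using that m by simp
    then have "F mod m = 0"
      using least[of "F mod m"] degree_mod_less[of m F] m by force
    then show ?thesis by auto
  qed
  have nonconst: "degree F \<noteq> 0" if "F \<noteq> 0" "rat_poly_at F s = 0" for F and s :: complex
  proof
    assume "degree F = 0"
    then obtain c where "F = [:c:]" by (rule degree_eq_zeroE)
    with that show False by (simp add: map_poly_pCons)
  qed
  have deg: "degree m \<noteq> 0" using m by (rule nonconst)
  have conj: "s = s0" if s: "rat_poly_at m s = 0" for s :: complex
  proof (rule sole)
    show "rat_poly_at F s = 0" if "rat_poly_at F s0 = 0" for F
      using dvd[OF that] s by (auto elim!: dvdE)
    show "rat_poly_at N s \<noteq> 0"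
    proof
      assume Ns: "rat_poly_at N s = 0"
      \<comment> \<open>By Bezout \<open>g\<close> also vanishes at \<open>s\<close>, so it is a
        nonconstant factor of \<open>m\<close>. As \<open>N\<close> is nonzero at \<open>s0\<close>,
        so is \<open>g\<close>; the cofactor \<open>h\<close> then vanishes at \<open>s0\<close> and
        has smaller degree than \<open>m\<close>.\<close>
      define g where "g = gcd m N"
      obtain u v where "u * m + v * N = g"
        unfolding g_def by (metis bezout_coefficients_fst_snd)
      moreover have "rat_poly_at (u * m + v * N) s = 0" using s Ns by simp
      ultimately have "rat_poly_at g s = 0" by simp
      moreover have "g \<noteq> 0" using m by (simp add: g_def)
      ultimately have dg: "degree g \<noteq> 0"
        using nonconst by blast
      obtain h where h: "m = g * h" unfolding g_def by (meson dvdE gcd_dvd1)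
      obtain k where k: "N = g * k" unfolding g_def by (meson dvdE gcd_dvd2)
      have "rat_poly_at h s0 = 0" using m(2) N unfolding h k by simp
      then have "degree m \<le> degree h" using least m h by auto
      then show False using h m dg by (simp add: degree_mult_eq)
    qed
  qed
  define M :: "complex poly" where "M = map_poly of_rat m"
  obtain h where h: "M = [:- s0, 1:] * h"
    using m unfolding M_def poly_eq_0_iff_dvd by (auto elim: dvdE)
  have M0: "M \<noteq> 0" using m by (simp add: M_def)
  \<comment> \<open>At a double root the derivative of \<open>m\<close> would vanish too; in
    characteristic 0 it is nonzero and of smaller degree.\<close>
  have simple: "poly h s0 \<noteq> 0"
  proof
    assume "poly h s0 = 0"
    then have "poly (pderiv M) s0 = 0" unfolding h pderiv_mult by (simp add: pderiv_pCons)
    moreover have "pderiv M = map_poly of_rat (pderiv m)"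
      by (rule poly_eqI) (simp add: M_def coeff_pderiv coeff_map_poly of_rat_mult of_rat_add)
    ultimately have "rat_poly_at (pderiv m) s0 = 0" by simp
    moreover have "pderiv m \<noteq> 0" using deg by (simp add: pderiv_eq_0_iff)
    ultimately have "degree m \<le> degree (pderiv m)" using least by blast
    then show False using deg by (simp add: degree_pderiv)
  qed
  \<comment> \<open>A root of \<open>h\<close> is a root of \<open>m\<close>, hence
    \<open>s0\<close>, against simplicity. A complex polynomial without roots is constant.\<close>
  have "poly h s \<noteq> 0" for s
  proof
    assume hs: "poly h s = 0"
    then have "poly M s = 0" by (simp add: h)
    then have "s = s0" using conj by (simp add: M_def)
    then show False using simple hs by simp
  qed
  then have "constant (poly h)" using fundamental_theorem_of_algebra by blast
  then have "degree h = 0" by (simp add: constant_degree)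
  then obtain e where e: "h = [:e:]" by (rule degree_eq_zeroE)
  with h M0 have "degree M = 1" by auto
  then have m1: "degree m = 1" by (simp add: M_def)
  define b c where "b = coeff m 0" and "c = coeff m 1"
  have bc: "m = [:b, c:]" "c \<noteq> 0"
    using m1 m(1) unfolding b_def c_def
    using leading_coeff_0_iff[of m]
    by (auto simp: poly_eq_iff coeff_pCons coeff_eq_0 simp del: leading_coeff_0_iff split: nat.splits)
  then have "of_rat b + s0 * of_rat c = 0" using m(2) by (simp add: map_poly_pCons)
  then have "s0 = of_rat (- b / c)" using bc(2)
    by (simp add: of_rat_divide of_rat_minus field_simps add_eq_0_iff2)
  then show ?thesis ..
qed


section \<open>Descent of coefficients from the reals to the rationals\<close>

text \<open>Extend \<open>{1}\<close> to a basis of the reals over the rationals and take the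
  coordinate along 1.\<close>

lemma exists_rat_linear_retraction:
  "\<exists>\<phi> :: real \<Rightarrow> real. (\<forall>x y. \<phi> (x + y) = \<phi> x + \<phi> y) \<and>
     (\<forall>r x. \<phi> (of_rat r * x) = of_rat r * \<phi> x) \<and> (\<forall>x. \<phi> x \<in> \<rat>) \<and> \<phi> 1 = 1"
proof -
  interpret V: vector_space "\<lambda>(r::rat) (x::real). of_rat r * x"
    by unfold_locales (auto simp: algebra_simps of_rat_add of_rat_mult)
  define B where "B = V.extend_basis {1}"
  have ind: "V.independent {1}" by simp
  have B: "1 \<in> B" "V.independent B" "V.span B = UNIV"
    using V.extend_basis_superset[OF ind] V.independent_extend_basis[OF ind] V.span_extend_basis[OF ind]
    by (auto simp: B_def)
  define \<phi> :: "real \<Rightarrow> real" where "\<phi> x = of_rat (V.representation B x 1)" for x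
  have "\<phi> (x + y) = \<phi> x + \<phi> y" for x y
    using B by (simp add: \<phi>_def V.representation_add of_rat_add)
  moreover have "\<phi> (of_rat r * x) = of_rat r * \<phi> x" for r x
    using B by (simp add: \<phi>_def V.representation_scale of_rat_mult)
  moreover have "\<phi> 1 = 1"
    using B by (simp add: \<phi>_def V.representation_basis)
  moreover have "\<phi> x \<in> \<rat>" for x by (simp add: \<phi>_def)
  ultimately show ?thesis by blast
qed

lemma rat_coeffs_if_rat_values:
  fixes p q :: "real poly"
  assumes cop: "coprime p q" and q: "q \<noteq> 0"
    and inf: "infinite {t::rat. poly q (of_rat t) \<noteq> 0 \<and> poly p (of_rat t) / poly q (of_rat t) \<in> \<rat>}"
  shows "\<exists>c. c \<noteq> 0 \<and> (\<forall>j. c * coeff p j \<in> \<rat>) \<and> (\<forall>j. c * coeff q j \<in> \<rat>)"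
proof -
  obtain \<phi> :: "real \<Rightarrow> real" where
    add: "\<And>x y. \<phi> (x + y) = \<phi> x + \<phi> y" and
    scale: "\<And>r x. \<phi> (of_rat r * x) = of_rat r * \<phi> x" and
    rat: "\<And>x. \<phi> x \<in> \<rat>" and one: "\<phi> 1 = 1"
    using exists_rat_linear_retraction by blast
  have zero: "\<phi> 0 = 0" using scale[of 0 0] by simp
  \<comment> \<open>A common factor of \<open>p\<close> and \<open>q\<close> is the only freedom;
    making the denominator monic fixes it at a value that \<phi> respects, since
    \<open>\<phi> 1 = 1\<close>.\<close>
  define c where "c = 1 / lead_coeff q"
  have c: "c \<noteq> 0" using q by (simp add: c_def)
  define p1 q1 where "p1 = smult c p" and "q1 = smult c q"
  have monic: "lead_coeff q1 = 1" using q by (simp add: q1_def c_def)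
  then have q1: "q1 \<noteq> 0" by auto
  have cop1: "coprime q1 p1"
    using c coprime_divisors[of q1 q p1 p] cop
    by (simp add: p1_def q1_def coprime_commute smult_dvd)
  define p2 q2 where "p2 = map_poly \<phi> p1" and "q2 = map_poly \<phi> q1"
  \<comment> \<open>At a rational \<open>t\<close> all powers of \<open>t\<close> are rational
    scalars, so the linear map \<phi> commutes with evaluation.\<close>
  have ev: "poly (map_poly \<phi> F) (of_rat t) = \<phi> (poly F (of_rat t))" for F t
    by (induction F) (simp_all add: map_poly_pCons zero add scale)
  have "p2 * q1 - p1 * q2 = 0"
  proof (rule poly_eq_0_if_infinite_roots)
    show "infinite (of_rat ` {t::rat. poly q (of_rat t) \<noteq> 0 \<and> poly p (of_rat t) / poly q (of_rat t) \<in> \<rat>} :: real set)"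
      using inf by (subst finite_image_iff) (auto simp: inj_on_def)
    fix t :: real
    assume "t \<in> of_rat ` {t::rat. poly q (of_rat t) \<noteq> 0 \<and> poly p (of_rat t) / poly q (of_rat t) \<in> \<rat>}"
    then obtain r y where r: "t = of_rat r" "poly q t \<noteq> 0" "poly p t / poly q t = of_rat y"
      by (auto elim!: Rats_cases)
    then have y: "poly p1 t = of_rat y * poly q1 t"
      by (simp add: p1_def q1_def divide_eq_eq)
    \<comment> \<open>The value \<open>y\<close> is rational as well, so \<phi> takes it out of the
      product.\<close>
    then have "poly p2 t = of_rat y * poly q2 t"
      by (simp add: p2_def q2_def r(1) ev scale)
    with y show "poly (p2 * q1 - p1 * q2) t = 0" by simp
  qed
  then have eq: "p2 * q1 = p1 * q2" by simp
  \<comment> \<open>Coprimality makes \<open>q1\<close> a divisor of \<open>q2\<close>. The degree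
    of \<open>q2\<close> is no larger, so the cofactor is constant, and comparing leading
    coefficients shows that it is 1.\<close>
  then have "q1 dvd p1 * q2" by (metis dvd_triv_right)
  then have "q1 dvd q2" using cop1 by (simp add: coprime_dvd_mult_right_iff)
  then obtain h where h: "q2 = q1 * h" by (rule dvdE)
  have lead: "coeff q2 (degree q1) = 1" using monic by (simp add: q2_def coeff_map_poly zero one)
  then have q2: "q2 \<noteq> 0" by auto
  moreover have "degree q2 \<le> degree q1"
    by (rule degree_le) (simp add: q2_def coeff_map_poly zero coeff_eq_0)
  ultimately have "degree h = 0" using h q1 by (simp add: degree_mult_eq)
  then obtain e where "h = [:e:]" by (rule degree_eq_zeroE)
  with lead h monic have "q2 = q1" by simp
  moreover from this eq q1 have "p2 = p1" by simp
  ultimately have "coeff p1 j \<in> \<rat>" "coeff q1 j \<in> \<rat>" for j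
    using rat by (metis coeff_map_poly p2_def zero, metis coeff_map_poly q2_def zero)
  with c show ?thesis by (auto simp: p1_def q1_def)
qed

section \<open>Lines through the eye point\<close>

abbreviation of_rat_vec :: "rat^'n \<Rightarrow> ('f::field_char_0)^'n" where
  "of_rat_vec v \<equiv> (\<chi> i. of_rat (v $ i))"

text \<open>These are the Pluecker coordinates of the line through \<open>u\<close> and
  \<open>v\<close>.\<close>

definition minor :: "'f::field^'n \<Rightarrow> 'f^'n \<Rightarrow> 'n \<Rightarrow> 'n \<Rightarrow> 'f" where
  "minor u v i j = u $ i * v $ j - u $ j * v $ i"

text \<open>If all minors vanish, the ratio at a coordinate where \<open>u\<close> is nonzero makes
  \<open>v\<close> a multiple of \<open>u\<close>, by a nonzero factor because \<open>v\<close> is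
  nonzero. Excluding only nonzero \<open>k\<close> matches \<open>proj_eq\<close>.\<close>

lemma exists_minor_nonzero:
  fixes u v :: "'f::field^'n"
  assumes "u \<noteq> 0" "v \<noteq> 0" "\<And>k. k \<noteq> 0 \<Longrightarrow> v \<noteq> k *s u"
  shows "\<exists>i j. minor u v i j \<noteq> 0"
proof (rule ccontr)
  assume "\<not> ?thesis"
  then have z: "u $ i * v $ j = u $ j * v $ i" for i j by (simp add: minor_def)
  obtain i where i: "u $ i \<noteq> 0" using assms(1) by (metis vec_eq_iff zero_index)
  have v: "v = (v $ i / u $ i) *s u"
    using z[of i] i by (simp add: vec_eq_iff field_simps)
  then have "v $ i \<noteq> 0" using assms(2) by (metis div_0 vector_smult_lzero)
  then show False using v assms(3) i by (metis divide_eq_0_iff)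
qed

text \<open>Coordinates \<open>i\<close> and \<open>j\<close> determine the two coefficients by
  Cramer's rule. Clearing the denominator leaves equations linear in \<open>w\<close>, which become
  polynomial equations when \<open>w\<close> is a parametrized point.\<close>

lemma in_line_iff_cramer:
  fixes u v w :: "'f::field^'n"
  assumes "minor u v i j \<noteq> 0"
  shows "(\<exists>\<alpha> \<beta>. w = \<alpha> *s u + \<beta> *s v) \<longleftrightarrow>
    (\<forall>k. minor u v i j * w $ k = minor w v i j * u $ k + minor u w i j * v $ k)"
proof
  assume "\<exists>\<alpha> \<beta>. w = \<alpha> *s u + \<beta> *s v"
  then show "\<forall>k. minor u v i j * w $ k = minor w v i j * u $ k + minor u w i j * v $ k"
    by (auto simp: minor_def algebra_simps)
next
  assume *: "\<forall>k. minor u v i j * w $ k = minor w v i j * u $ k + minor u w i j * v $ k"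
  have "w = (minor w v i j / minor u v i j) *s u + (minor u w i j / minor u v i j) *s v"
    using * assms by (simp add: vec_eq_iff divide_simps mult.commute)
  then show "\<exists>\<alpha> \<beta>. w = \<alpha> *s u + \<beta> *s v" by blast
qed

abbreviation lin :: "'f::field^'n \<Rightarrow> 'f^'n \<Rightarrow> 'f" where
  "lin l v \<equiv> (\<Sum>i\<in>UNIV. l $ i * v $ i)"

lemma lin_comb: "lin l (\<alpha> *s u + \<beta> *s v) = \<alpha> * lin l u + \<beta> * lin l v"
  by (simp add: algebra_simps sum.distrib sum_distrib_left)

lemma homog_nth [simp]:
  "homog w $ 1 = w $ 1" "homog w $ 2 = w $ 2" "homog w $ 3 = w $ 3" "homog w $ 4 = 1"
  by (simp_all add: homog_def vector_def)

text \<open>Here \<open>l\<close> is the equation of the plane and \<open>a\<close> the eye point: a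
  line through a point off the plane meets the plane only once.\<close>

lemma homog_eq_if_on_line:
  fixes l a p :: "'f::field^4" and u v :: "'f^3"
  assumes "lin l a \<noteq> 0" "lin l (homog u) = 0" "lin l (homog v) = 0"
    and u: "homog u = \<alpha> *s a + \<beta> *s p" and v: "homog v = \<alpha>' *s a + \<beta>' *s p"
  shows "u = v"
proof -
  have eqs: "\<alpha> * lin l a + \<beta> * lin l p = 0" "\<alpha>' * lin l a + \<beta>' * lin l p = 0"
    using assms(2,3) unfolding u v lin_comb by auto
  \<comment> \<open>Eliminating \<open>lin l p\<close> shows that the two coefficient pairs are
    proportional; the fourth coordinates, both 1, then make them yield the same point.\<close>
  then have "(\<alpha> * \<beta>') * lin l a = (\<alpha>' * \<beta>) * lin l a" by algebra
  then have ab: "\<alpha> * \<beta>' = \<alpha>' * \<beta>" using assms(1) by simp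
  have "\<beta> \<noteq> 0"
  proof
    assume "\<beta> = 0"
    with eqs assms(1) have "\<alpha> = 0" by simp
    with u \<open>\<beta> = 0\<close> homog_nth(4)[of u] show False by simp
  qed
  have comp: "\<beta>' * homog u $ k = \<beta> * homog v $ k" for k
    unfolding u v using ab by (simp add: algebra_simps)
  from comp[of 4] have "\<beta>' = \<beta>" by simp
  with comp \<open>\<beta> \<noteq> 0\<close> have e: "homog u $ k = homog v $ k" for k by simp
  show ?thesis
    using e[of 1] e[of 2] e[of 3] by (simp add: vec_eq_iff forall_3)
qed

section \<open>Forms and projective closures\<close>

lemma form_smult: "form d c (k *s v) = k ^ d * form d c v"
  unfolding form_def sum_distrib_left
  by (rule sum.cong) (auto simp: power_mult_distrib prod.distrib power_sum)

lemma form_on_line_is_poly: "\<exists>P. \<forall>k. poly P k = form d c (u + k *s v)"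
proof (intro exI allI)
  show "poly (\<Sum>\<alpha>\<in>{\<alpha>. (\<Sum>i\<in>UNIV. \<alpha> i) = d}. [:c \<alpha>:] * (\<Prod>i\<in>UNIV. [:u $ i, v $ i:] ^ \<alpha> i)) k
      = form d c (u + k *s v)" for k
    by (simp add: form_def poly_sum poly_prod poly_mult poly_power)
qed

text \<open>On a line the form is a polynomial in \<open>k\<close>, so infinitely many zeros force a
  zero at \<open>k = 0\<close>. This algebraic limit reaches points at infinity from affine
  ones.\<close>

lemma form_vanishes_at_endpoint:
  assumes "infinite T" "\<And>k. k \<in> T \<Longrightarrow> form d c (u + k *s v) = 0"
  shows "form d c u = 0"
proof -
  obtain P where P: "\<And>k. poly P k = form d c (u + k *s v)"
    using form_on_line_is_poly by metis
  with assms have "P = 0" by (intro poly_eq_0_if_infinite_roots) auto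
  with P[of 0] show ?thesis by simp
qed

lemma lin_is_form: "\<exists>c. \<forall>v. form 1 c v = lin l v"
proof -
  \<comment> \<open>\<open>e i\<close> is the exponent vector of the monomial in the single variable
    \<open>i\<close>, so \<open>c\<close> is supported on the degree-one monomials.\<close>
  define e :: "4 \<Rightarrow> 4 \<Rightarrow> nat" where "e i j = (if i = j then 1 else 0)" for i j
  define c where "c \<alpha> = (\<Sum>i\<in>UNIV. if \<alpha> = e i then l $ i else 0)" for \<alpha>
  have sum_e: "(\<Sum>j\<in>UNIV. e i j) = 1" for i by (simp add: e_def)
  have "form 1 c v = lin l v" for v
  proof -
    have "form 1 c v = (\<Sum>\<alpha>\<in>{\<alpha>. (\<Sum>i\<in>UNIV. \<alpha> i) = 1}. \<Sum>i\<in>UNIV.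
        if \<alpha> = e i then l $ i * (\<Prod>j\<in>UNIV. v $ j ^ e i j) else 0)"
      unfolding form_def c_def sum_distrib_right
      by (intro sum.cong) auto
    also have "\<dots> = (\<Sum>i\<in>UNIV. \<Sum>\<alpha>\<in>{\<alpha>. (\<Sum>i\<in>UNIV. \<alpha> i) = 1}.
        if \<alpha> = e i then l $ i * (\<Prod>j\<in>UNIV. v $ j ^ e i j) else 0)"
      by (rule sum.swap)
    also have "\<dots> = (\<Sum>i\<in>UNIV. l $ i * (\<Prod>j\<in>UNIV. v $ j ^ e i j))"
      using finite_exponents_of_degree[of 1] by (intro sum.cong) (auto simp: sum.delta sum_e)
    also have "\<dots> = lin l v"
    proof (intro sum.cong refl)
      fix i
      have "(\<Prod>j\<in>UNIV. v $ j ^ e i j) = (\<Prod>j\<in>UNIV. if i = j then v $ j else 1)"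
        by (intro prod.cong) (auto simp: e_def)
      then show "l $ i * (\<Prod>j\<in>UNIV. v $ j ^ e i j) = l $ i * v $ i" by simp
    qed
    finally show ?thesis .
  qed
  then show ?thesis by blast
qed

lemma lin_vanishes_on_closure:
  assumes "\<And>u. u \<in> S \<Longrightarrow> lin l (homog (complexify u)) = 0" "v \<in> proj_closure S"
  shows "lin l v = 0"
proof -
  obtain c where c: "\<forall>v. form 1 c v = lin l v" using lin_is_form by blast
  have "(\<forall>u\<in>S. form 1 c (homog (complexify u)) = 0) \<longrightarrow> form 1 c v = 0"
    using assms(2) unfolding proj_closure_def by blast
  then show ?thesis using assms(1) unfolding c[rule_format] by blast
qed

lemma homog_ne_0 [simp]: "homog v \<noteq> 0"
  by (metis homog_nth(4) zero_index zero_neq_one)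

lemma in_proj_closure: "u \<in> S \<Longrightarrow> homog (complexify u) \<in> proj_closure S"
  by (simp add: proj_closure_def)

text \<open>Affine points are rescaled into \<open>E\<close>; points at infinity are limits of
  affine ones. Contraposition shows that an eye point outside the closure violates the plane
  equation.\<close>

lemma hyperplane_points_in_closure:
  fixes n :: "real^3" and a :: "real^4"
  assumes E: "E = {x. n \<bullet> x = b}" and "E \<noteq> {}" and "a \<noteq> 0"
    and a: "n $ 1 * a $ 1 + n $ 2 * a $ 2 + n $ 3 * a $ 3 = b * a $ 4"
  shows "complexify a \<in> proj_closure E"
proof -
  have "form d c (complexify a) = 0" if van: "\<forall>u\<in>E. form d c (homog (complexify u)) = 0" for d c
  proof -
    have affine: "form d c (complexify w) = 0"
      if w: "n $ 1 * w $ 1 + n $ 2 * w $ 2 + n $ 3 * w $ 3 = b * w $ 4" "w $ 4 \<noteq> 0" for w :: "real^4"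
    proof -
      define u :: "real^3" where "u = (\<chi> i. (if i = 1 then w $ 1 else if i = 2 then w $ 2 else w $ 3) / w $ 4)"
      have "u \<in> E" unfolding E using w by (simp add: inner_vec_def sum_3 u_def field_simps)
      moreover have "complexify w = of_real (w $ 4) *s homog (complexify u)"
        using w(2) by (simp add: vec_eq_iff forall_4 complexify_def u_def)
      ultimately show ?thesis using van by (simp add: form_smult)
    qed
    show ?thesis
    proof (cases "a $ 4 = 0")
      case True
      \<comment> \<open>For \<open>a\<close> at infinity, join it to an affine point
        \<open>w\<close> of the plane: each \<open>a + r *s w\<close> with \<open>r > 0\<close> is
        affine and satisfies the plane equation, and \<open>r = 0\<close> gives back
        \<open>a\<close>.\<close>
      obtain u where u: "u \<in> E" using \<open>E \<noteq> {}\<close> by blast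
      define w :: "real^4" where "w = homog u"
      have w: "n $ 1 * w $ 1 + n $ 2 * w $ 2 + n $ 3 * w $ 3 = b * w $ 4" "w $ 4 = 1"
        using u unfolding E by (simp_all add: inner_vec_def sum_3 w_def)
      show ?thesis
      proof (rule form_vanishes_at_endpoint)
        show "infinite (complex_of_real ` {0<..})"
          by (subst finite_image_iff) (auto simp: inj_on_def infinite_Ioi)
        fix k assume "k \<in> complex_of_real ` {0<..}"
        then obtain r where r: "k = of_real r" "r > 0" by auto
        have "form d c (complexify (a + r *s w)) = 0"
        proof (rule affine)
          show "n $ 1 * (a + r *s w) $ 1 + n $ 2 * (a + r *s w) $ 2 + n $ 3 * (a + r *s w) $ 3 = b * (a + r *s w) $ 4"
            using a arg_cong[OF w(1), of "\<lambda>x. r * x"] by (simp add: algebra_simps)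
        qed (use True r w in auto)
        moreover have "complexify (a + r *s w) = complexify a + k *s complexify w"
          by (simp add: complexify_def vec_eq_iff r)
        ultimately show "form d c (complexify a + k *s complexify w) = 0" by simp
      qed
    qed (use affine a in blast)
  qed
  moreover have "complexify a \<noteq> 0" using \<open>a \<noteq> 0\<close> by (auto simp: complexify_def vec_eq_iff)
  ultimately show ?thesis by (auto simp: proj_closure_def)
qed

lemma plane_form_separating:
  fixes a :: "real^4"
  assumes "affine E" "aff_dim E = 2" "a \<noteq> 0" "complexify a \<notin> proj_closure E"
  obtains l where "\<And>v. v \<in> proj_closure E \<Longrightarrow> lin l v = 0" "lin l (complexify a) \<noteq> 0"
proof -
  have "aff_dim E = int (DIM(real^3) - 1)" using assms(2) by simp
  from iffD1[OF aff_dim_eq_hyperplane this] obtain n b where E: "affine hull E = {x. n \<bullet> x = b}"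
    by metis
  have E: "E = {x. n \<bullet> x = b}" using E assms(1) by (metis affine_hull_eq)
  have "E \<noteq> {}" using assms(2) by auto
  \<comment> \<open>The homogenized equation of the plane.\<close>
  define l :: "complex^4" where "l = complexify (vector [n $ 1, n $ 2, n $ 3, - b])"
  have vec4: "(vector [w, x, y, z] :: real^4) $ 1 = w" "(vector [w, x, y, z] :: real^4) $ 2 = x"
    "(vector [w, x, y, z] :: real^4) $ 3 = y" "(vector [w, x, y, z] :: real^4) $ 4 = z" for w x y z :: real
    by (simp_all add: vector_def)
  have lin: "lin l v = of_real (n $ 1) * v $ 1 + of_real (n $ 2) * v $ 2 + of_real (n $ 3) * v $ 3 - of_real b * v $ 4" for v
    by (simp add: sum_4 l_def complexify_def vec4)
  show ?thesis
  proof
    show "lin l v = 0" if "v \<in> proj_closure E" for v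
    proof (rule lin_vanishes_on_closure[OF _ that])
      fix u assume "u \<in> E"
      then have "n $ 1 * u $ 1 + n $ 2 * u $ 2 + n $ 3 * u $ 3 - b = 0" unfolding E by (simp add: inner_vec_def sum_3)
      then have "complex_of_real (n $ 1 * u $ 1 + n $ 2 * u $ 2 + n $ 3 * u $ 3 - b) = 0" by simp
      then show "lin l (homog (complexify u)) = 0" unfolding lin by (simp add: complexify_def)
    qed
    show "lin l (complexify a) \<noteq> 0"
    proof
      assume "lin l (complexify a) = 0"
      then have "complex_of_real (n $ 1 * a $ 1 + n $ 2 * a $ 2 + n $ 3 * a $ 3 - b * a $ 4) = 0"
        unfolding lin by (simp add: complexify_def)
      then have "n $ 1 * a $ 1 + n $ 2 * a $ 2 + n $ 3 * a $ 3 = b * a $ 4" unfolding of_real_eq_0_iff by simp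
      then show False using hyperplane_points_in_closure[OF E \<open>E \<noteq> {}\<close>] assms(3,4) by blast
    qed
  qed
qed

section \<open>Homogeneous coordinates of a parametrization\<close>

text \<open>Clearing the three denominators by their product gives polynomial homogeneous
  coordinates whose fourth entry vanishes exactly at the poles.\<close>

definition hom_poly :: "rat_param \<Rightarrow> rat poly ^ 4" where
  "hom_poly x =
    (let n = \<lambda>i. fst (quot_of_fract (x $ i)); d = \<lambda>i. snd (quot_of_fract (x $ i))
     in \<chi> k. if k = 1 then n 1 * d 2 * d 3 else if k = 2 then d 1 * n 2 * d 3
        else if k = 3 then d 1 * d 2 * n 3 else d 1 * d 2 * d 3)"

lemma param_dom_iff: "s \<in> param_dom x \<longleftrightarrow> rat_poly_at (hom_poly x $ 4) s \<noteq> 0"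
  by (auto simp: param_dom_def ratfun_pole_def forall_3 hom_poly_def Let_def)

lemma hom_poly_at:
  assumes "s \<in> param_dom x"
  shows "rat_poly_at (hom_poly x $ k) s = rat_poly_at (hom_poly x $ 4) s * homog (param_at x s) $ k"
  using assms exhaust_4[of k]
  by (auto simp: param_dom_def param_at_def ratfun_eval_def ratfun_pole_def forall_3 hom_poly_def Let_def)

lemma finite_non_dom: "finite (- param_dom x :: 'f::field_char_0 set)"
proof -
  have "hom_poly x $ 4 \<noteq> 0" by (simp add: hom_poly_def Let_def snd_quot_of_fract_nonzero)
  then have "finite {s :: 'f. rat_poly_at (hom_poly x $ 4) s = 0}"
    by (intro poly_roots_finite) simp
  then show ?thesis by (rule rev_finite_subset) (auto simp: param_dom_iff)
qed

text \<open>Multiplied by the common denominator, the linear form along the parametrization is a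
  polynomial, and it has infinitely many zeros.\<close>

lemma lin_param_vanishes:
  fixes T :: "'f::field_char_0 set"
  assumes "infinite T" "\<And>t. t \<in> T \<Longrightarrow> t \<in> param_dom x"
    "\<And>t. t \<in> T \<Longrightarrow> lin l (homog (param_at x t)) = 0" "s \<in> param_dom x"
  shows "lin l (homog (param_at x s)) = 0"
proof -
  define P where "P = (\<Sum>k\<in>UNIV. smult (l $ k) (map_poly of_rat (hom_poly x $ k)))"
  have P: "poly P t = rat_poly_at (hom_poly x $ 4) t * lin l (homog (param_at x t))" if "t \<in> param_dom x" for t
  proof -
    have "poly P t = (\<Sum>k\<in>UNIV. l $ k * rat_poly_at (hom_poly x $ k) t)" by (simp add: P_def poly_sum)
    also have "\<dots> = (\<Sum>k\<in>UNIV. l $ k * (rat_poly_at (hom_poly x $ 4) t * homog (param_at x t) $ k))"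
      by (simp only: hom_poly_at[OF that, symmetric])
    also have "\<dots> = rat_poly_at (hom_poly x $ 4) t * lin l (homog (param_at x t))"
      by (simp add: sum_distrib_left mult.left_commute)
    finally show ?thesis .
  qed
  have "P = 0"
    by (rule poly_eq_0_if_infinite_roots[OF assms(1)]) (simp only: P assms(2,3) mult_zero_right)
  then show ?thesis using P[OF assms(4)] assms(4) by (simp add: param_dom_iff)
qed

lemma param_dom_of_real: "complex_of_real t \<in> param_dom x \<longleftrightarrow> t \<in> param_dom x"
  by (simp add: param_dom_iff rat_poly_at_of_real)

lemma param_at_of_real: "param_at x (complex_of_real t) = complexify (param_at x t)"
  by (simp add: param_at_def complexify_def ratfun_eval_def rat_poly_at_of_real vec_eq_iff)

lemma param_at_of_rat: "\<exists>P. homog (param_at x (of_rat t)) = of_rat_vec P"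
proof -
  \<comment> \<open>At a pole both divisions by zero return 0, so the identity holds there
    too.\<close>
  define v :: "rat^3" where "v = (\<chi> i. poly (fst (quot_of_fract (x $ i))) t / poly (snd (quot_of_fract (x $ i))) t)"
  have "homog (param_at x (of_rat t)) = of_rat_vec (homog v)"
    by (simp add: vec_eq_iff forall_4 param_at_def ratfun_eval_def rat_poly_at_of_rat v_def of_rat_divide)
  then show ?thesis by blast
qed

lemma real_param_in_proj_curve:
  assumes "t \<in> param_dom x"
  shows "homog (param_at x (complex_of_real t)) \<in> proj_curve x"
  unfolding proj_curve_def param_at_of_real using assms by (intro in_proj_closure) auto

lemma infinite_real_dom: "infinite (param_dom x :: real set)"
proof
  assume "finite (param_dom x :: real set)"
  with finite_non_dom[of x, where 'f = real] show False using infinite_UNIV_char_0[where 'a = real] by simp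
qed

text \<open>The curve is defined from its real points; there are infinitely many real parameters,
  and these control all complex ones.\<close>

lemma lin_vanishes_on_param:
  assumes "\<And>v. v \<in> proj_curve x \<Longrightarrow> lin l v = 0" "s \<in> param_dom x"
  shows "lin l (homog (param_at x s)) = 0"
proof (rule lin_param_vanishes[OF _ _ _ assms(2)])
  show "infinite (complex_of_real ` param_dom x)"
    using infinite_real_dom by (subst finite_image_iff) (auto simp: inj_on_def)
  fix t assume "t \<in> complex_of_real ` param_dom x"
  then obtain r where r: "t = of_real r" "r \<in> param_dom x" by blast
  then show "t \<in> param_dom x" by (simp add: param_dom_of_real)
  show "lin l (homog (param_at x t)) = 0"
    unfolding r(1) by (rule assms(1)[OF real_param_in_proj_curve[OF r(2)]])
qed

section \<open>Rationality of the parameter over a rational point\<close>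

text \<open>The polynomial \<open>N\<close> serves to stay away not only from the exceptional parameters but also from
  their conjugates over the rationals.\<close>

lemma exists_poly_vanishing_on_algebraic:
  fixes S :: "complex set"
  assumes "finite S"
  shows "\<exists>N. N \<noteq> 0 \<and> (\<forall>b\<in>S. \<forall>F. F \<noteq> 0 \<longrightarrow> rat_poly_at F b = 0 \<longrightarrow> rat_poly_at N b = 0)"
  using assms
proof induction
  case (insert b S)
  then obtain N where N: "N \<noteq> 0"
    "\<forall>b\<in>S. \<forall>F. F \<noteq> 0 \<longrightarrow> rat_poly_at F b = 0 \<longrightarrow> rat_poly_at N b = 0" by blast
  \<comment> \<open>An algebraic \<open>b\<close> contributes an annihilating factor; for a
    transcendental \<open>b\<close> the condition is vacuous.\<close>
  show ?case
  proof (cases "\<exists>F. F \<noteq> 0 \<and> rat_poly_at F b = 0")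
    case True
    then obtain F where "F \<noteq> 0" "rat_poly_at F b = 0" by blast
    with N show ?thesis by (intro exI[of _ "F * N"]) auto
  next
    case False
    with N show ?thesis by (intro exI[of _ N]) auto
  qed
qed (intro exI[of _ 1], simp)

text \<open>Lying over the line through \<open>A\<close> and \<open>P\<close> is a system of
  rational polynomial equations in the parameter, so it passes to every conjugate of
  \<open>s0\<close>; injectivity then identifies the conjugates outside \<open>S\<close> with
  \<open>s0\<close>.\<close>

lemma rational_parameter_over_rational_line:
  fixes x :: rat_param and l :: "complex^4" and A P :: "rat^4" and s0 :: complex
  assumes inj: "inj_on (param_at x) (param_dom x - S)" and "finite S"
    and N: "\<And>b F. b \<in> S \<Longrightarrow> F \<noteq> 0 \<Longrightarrow> rat_poly_at F b = 0 \<Longrightarrow> rat_poly_at N b = 0"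
    and l: "\<And>s. s \<in> param_dom x \<Longrightarrow> lin l (homog (param_at x s)) = 0" "lin l (of_rat_vec A) \<noteq> 0"
    and ij: "minor (of_rat_vec A :: complex^4) (of_rat_vec P) i j \<noteq> 0"
    and s0: "s0 \<in> param_dom x - S" "rat_poly_at N s0 \<noteq> 0"
    and line: "homog (param_at x s0) = \<alpha> *s of_rat_vec A + \<beta> *s of_rat_vec P"
  shows "\<exists>r. s0 = of_rat r"
proof -
  let ?A = "of_rat_vec A :: complex^4" and ?P = "of_rat_vec P :: complex^4"
  define V where "V = hom_poly x"
  \<comment> \<open>The \<open>k\<close>-th Cramer equation for the point with parameter
    \<open>s\<close>, multiplied by the common denominator.\<close>
  define F where "F k = smult (minor A P i j) (V $ k)
      - smult (A $ k) (smult (P $ j) (V $ i) - smult (P $ i) (V $ j))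
      - smult (P $ k) (smult (A $ i) (V $ j) - smult (A $ j) (V $ i))" for k
  have F_at: "rat_poly_at (F k) s = 0 \<longleftrightarrow>
      minor ?A ?P i j * w $ k = minor w ?P i j * ?A $ k + minor ?A w i j * ?P $ k"
    if s: "s \<in> param_dom x" and w: "w = homog (param_at x s)" for k s w
  proof -
    define D where "D = rat_poly_at (V $ 4) s"
    have D: "D \<noteq> 0" using s by (simp add: D_def V_def param_dom_iff)
    have V: "rat_poly_at (V $ m) s = D * w $ m" for m
      using hom_poly_at[OF s] unfolding D_def V_def w .
    have "rat_poly_at (F k) s
        = D * (minor ?A ?P i j * w $ k - (minor w ?P i j * ?A $ k + minor ?A w i j * ?P $ k))"
      by (simp add: F_def V minor_def of_rat_diff of_rat_mult algebra_simps)
    then show ?thesis using D by simp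
  qed
  have fibre: "param_at x s = param_at x s0"
    if s: "s \<in> param_dom x" "\<And>k. rat_poly_at (F k) s = 0" for s
  proof -
    have "\<exists>\<alpha> \<beta>. homog (param_at x s) = \<alpha> *s ?A + \<beta> *s ?P"
      unfolding in_line_iff_cramer[OF ij] using F_at[OF s(1) refl] s(2) by blast
    then obtain \<alpha>' \<beta>' where "homog (param_at x s) = \<alpha>' *s ?A + \<beta>' *s ?P" by blast
    then show ?thesis
      using homog_eq_if_on_line[OF l(2) l(1)[OF s(1)] l(1) _ line] s0(1) by blast
  qed
  have F_s0: "rat_poly_at (F k) s0 = 0" for k
  proof -
    have "\<exists>\<alpha> \<beta>. homog (param_at x s0) = \<alpha> *s ?A + \<beta> *s ?P" using line by blast
    then show ?thesis
      unfolding in_line_iff_cramer[OF ij] using F_at[OF _ refl] s0(1) by blast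
  qed
  \<comment> \<open>If every equation were trivial, all parameters would give the same point,
    against injectivity outside the finite \<open>S\<close>. A nontrivial one makes
    \<open>s0\<close> algebraic.\<close>
  have "\<exists>k. F k \<noteq> 0"
  proof (rule ccontr)
    assume "\<not> ?thesis"
    then have "F k = 0" for k by blast
    then have "param_at x s = param_at x s0" if "s \<in> param_dom x - S" for s
      using that by (intro fibre) auto
    then have "param_dom x - S \<subseteq> {s0}" using inj s0(1) by (auto dest: inj_onD)
    then have "finite (param_dom x - S)" by (rule finite_subset) simp
    then have "finite (UNIV :: complex set)"
      using \<open>finite S\<close> finite_non_dom[of x, where 'f = complex] by simp
    then show False using infinite_UNIV_char_0 by blast
  qed
  then obtain k where k: "F k \<noteq> 0" ..
  show ?thesis
  \<comment> \<open>The factor \<open>N\<close> excludes conjugates lying in \<open>S\<close>, which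
    are algebraic as roots of \<open>F k\<close>; the factor \<open>V $ 4\<close> excludes
    poles.\<close>
  proof (rule rational_if_sole_conjugate[OF k F_s0, of "N * V $ 4"])
    show "rat_poly_at (N * V $ 4) s0 \<noteq> 0"
      using s0 by (simp add: V_def param_dom_iff)
    fix s :: complex
    assume conj: "\<And>G. rat_poly_at G s0 = 0 \<Longrightarrow> rat_poly_at G s = 0"
      and "rat_poly_at (N * V $ 4) s \<noteq> 0"
    then have s: "rat_poly_at N s \<noteq> 0" "s \<in> param_dom x" by (simp_all add: V_def param_dom_iff)
    have "s \<notin> S" using N[OF _ k conj[OF F_s0]] s(1) by blast
    moreover have "param_at x s = param_at x s0" using s(2) conj[OF F_s0] by (rule fibre)
    ultimately show "s = s0" using inj s(2) s0(1) by (auto dest: inj_onD)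
  qed
qed

section \<open>The associated function is not constant\<close>

lemma lin_axis: "lin (axis k 1) v = v $ k"
  by (simp add: axis_def if_distrib if_distribR cong: if_cong)

lemma lin_diff_left: "lin (l - m) v = lin l v - lin m v"
  by (simp add: left_diff_distrib sum_subtractf)

lemma lin_smult_left: "lin (c *s l) v = c * lin l v"
  by (simp add: sum_distrib_left mult.assoc)

text \<open>If infinitely many points of the first curve project to \<open>b\<close>, the line
  through \<open>a\<close> and \<open>b\<close> contains that whole curve. Surjectivity then makes
  \<open>x2\<close> constant at real parameters, against properness.\<close>

lemma projection_not_constant:
  assumes "proper_param x2"
    and onto: "projects_onto E a (proj_curve x1) (proj_curve x2)"
    and l: "\<And>v. v \<in> proj_closure E \<Longrightarrow> lin l v = 0" "lin l (complexify a) \<noteq> 0"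
    and T: "infinite T" "\<And>t. t \<in> T \<Longrightarrow> t \<in> param_dom x1"
    and proj: "\<And>t. t \<in> T \<Longrightarrow> projects_to E a (homog (param_at x1 t)) (homog b)"
  shows False
proof -
  define A where "A = complexify a"
  define r0 where "r0 = homog b"
  have "T \<noteq> {}" using T(1) by auto
  then have r0: "lin l r0 = 0" using proj l(1) by (auto simp: projects_to_def r0_def)
  have A: "lin l A \<noteq> 0" using l(2) by (simp add: A_def)
  have not_mult: "r0 \<noteq> c *s A" for c
  proof
    assume r: "r0 = c *s A"
    then have "c * lin l A = 0" using r0 lin_comb[of l c A 0 0] by simp
    then have "r0 = 0" using r A by simp
    then show False by (simp add: r0_def)
  qed
  have "A \<noteq> 0" using A by auto
  then obtain i j where ij: "minor A r0 i j \<noteq> 0"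
    using exists_minor_nonzero[of A r0] not_mult by (auto simp: r0_def)
  \<comment> \<open>The Cramer equations of the line as linear forms, so that lying on the line
    extends first to all parameters and then to the projective closure.\<close>
  define c where "c k = minor A r0 i j *s axis k 1
      - A $ k *s (r0 $ j *s axis i 1 - r0 $ i *s axis j 1)
      - r0 $ k *s (A $ i *s axis j 1 - A $ j *s axis i 1)" for k
  have lin_c: "lin (c k) v = minor A r0 i j * v $ k - (minor v r0 i j * A $ k + minor A v i j * r0 $ k)" for k v
    unfolding c_def lin_diff_left lin_smult_left lin_axis by (simp add: minor_def algebra_simps)
  have on_line: "(\<exists>\<alpha> \<beta>. v = \<alpha> *s A + \<beta> *s r0) \<longleftrightarrow> (\<forall>k. lin (c k) v = 0)" for v
    unfolding in_line_iff_cramer[OF ij] lin_c by simp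
  have "lin (c k) (homog (param_at x1 t)) = 0" if t: "t \<in> T" for t k
  proof -
    obtain \<alpha> \<beta> where r: "r0 = \<alpha> *s A + \<beta> *s homog (param_at x1 t)"
      using proj[OF t] by (auto simp: projects_to_def A_def r0_def)
    \<comment> \<open>\<open>r0\<close> lies in the plane and is no multiple of \<open>A\<close>, so
      the relation can be solved for the point of the first curve.\<close>
    have "\<beta> \<noteq> 0" using r not_mult[of \<alpha>] by auto
    then have "homog (param_at x1 t) = (- \<alpha> / \<beta>) *s A + (1 / \<beta>) *s r0"
      unfolding r by (simp add: vec_eq_iff field_simps)
    then show ?thesis using on_line by blast
  qed
  then have dom: "lin (c k) (homog (param_at x1 t)) = 0" if "t \<in> param_dom x1" for t k
    using lin_param_vanishes[OF T(1) T(2) _ that] by blast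
  have "lin (c k) v = 0" if v: "v \<in> proj_curve x1" for v k
  proof (rule lin_vanishes_on_closure[OF _ v[unfolded proj_curve_def]])
    fix u :: "real^3" assume "u \<in> param_at x1 ` param_dom x1"
    then obtain t where t: "u = param_at x1 t" "t \<in> param_dom x1" by blast
    show "lin (c k) (homog (complexify u)) = 0"
      unfolding t(1) param_at_of_real[symmetric] by (rule dom) (simp add: param_dom_of_real t(2))
  qed
  then have line1: "\<exists>\<alpha> \<beta>. v = \<alpha> *s A + \<beta> *s r0" if "v \<in> proj_curve x1" for v
    using on_line that by blast
  have const: "param_at x2 (complex_of_real t) = b" if t: "t \<in> param_dom x2" for t
  proof -
    define r where "r = homog (param_at x2 (complex_of_real t))"
    obtain p where p: "p \<in> proj_curve x1" "projects_to E a p r"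
      using onto real_param_in_proj_curve[OF t] unfolding projects_onto_def r_def by blast
    then obtain \<alpha> \<beta> where r: "r = \<alpha> *s A + \<beta> *s p" "r \<in> proj_closure E"
      by (auto simp: projects_to_def A_def)
    \<comment> \<open>The preimage \<open>p\<close> lies on the line through \<open>A\<close> and
      \<open>r0\<close>, hence so does its projection \<open>r\<close>; both \<open>r\<close> and
      \<open>r0\<close> lie in the plane, so they coincide.\<close>
    obtain \<alpha>' \<beta>' where "p = \<alpha>' *s A + \<beta>' *s r0" using line1[OF p(1)] by blast
    then have r': "r = (\<alpha> + \<beta> * \<alpha>') *s A + (\<beta> * \<beta>') *s r0"
      unfolding r(1) by (simp add: vec_eq_iff algebra_simps)
    have b: "homog b = 0 *s A + 1 *s r0" by (simp add: r0_def)
    show ?thesis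
      by (rule homog_eq_if_on_line[OF A _ _ r'[unfolded r_def] b])
         (use l(1)[OF r(2)] r0 in \<open>simp_all add: r_def r0_def\<close>)
  qed
  obtain S :: "complex set" where S: "finite S" "inj_on (param_at x2) (param_dom x2 - S)"
    using assms(1) by (auto simp: proper_param_def)
  define R where "R = complex_of_real ` param_dom x2 - S"
  have "infinite (complex_of_real ` param_dom x2)"
    using infinite_real_dom[of x2] by (subst finite_image_iff) (auto simp: inj_on_def)
  then have R: "infinite R" using S(1) by (simp add: R_def)
  then obtain t where t: "t \<in> R" by (metis ex_in_conv finite.emptyI)
  have "R \<subseteq> {t}"
  proof
    fix u assume u: "u \<in> R"
    have "param_at x2 u = param_at x2 t" using u t const by (auto simp: R_def)
    moreover have "u \<in> param_dom x2 - S" "t \<in> param_dom x2 - S"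
      using u t by (auto simp: R_def param_dom_of_real)
    ultimately show "u \<in> {t}" using S(2) by (auto dest: inj_onD)
  qed
  then show False using R finite_subset by blast
qed

section \<open>The associated polynomial\<close>

abbreviation real_poly_at :: "real poly \<Rightarrow> complex \<Rightarrow> complex" where
  "real_poly_at P z \<equiv> poly (map_poly of_real P) z"

lemma real_poly_at_mult: "real_poly_at (P * Q) z = real_poly_at P z * real_poly_at Q z"
  by (rule poly_map_poly_mult) simp_all

lemma real_poly_at_of_real: "real_poly_at P (of_real t) = of_real (poly P t)"
  by (induction P) (simp_all add: map_poly_pCons)

text \<open>\<open>ratfun_eval\<close> uses the pair from \<open>quot_of_fract\<close>; the
  cross-multiplied polynomial identity carries over to values where neither denominator
  vanishes.\<close>

lemma ratfun_eval_Fract: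
  assumes "q \<noteq> 0" "\<not> ratfun_pole of_real (Fraction_Field.Fract p q) t" "real_poly_at q t \<noteq> 0"
  shows "ratfun_eval of_real (Fraction_Field.Fract p q) t = real_poly_at p t / real_poly_at q t"
proof -
  define n d where "n = fst (quot_of_fract (Fraction_Field.Fract p q))"
    and "d = snd (quot_of_fract (Fraction_Field.Fract p q))"
  have "d \<noteq> 0" by (simp add: d_def snd_quot_of_fract_nonzero)
  have "Fraction_Field.Fract n d = Fraction_Field.Fract p q"
    unfolding n_def d_def by (rule Fract_quot_of_fract)
  then have "n * q = p * d" using \<open>d \<noteq> 0\<close> assms(1) by (simp add: eq_fract)
  then have "real_poly_at n t * real_poly_at q t = real_poly_at p t * real_poly_at d t"
    by (metis real_poly_at_mult)
  then show ?thesis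
    using assms(2,3) unfolding ratfun_eval_def ratfun_pole_def n_def[symmetric] d_def[symmetric]
    by (simp add: frac_eq_eq)
qed

theorem proposition11:
  fixes x1 x2 :: rat_param
    and E :: "(real^3) set"
    and a :: "real^4"
    and G :: "real poly poly"
  assumes "proper_param x1" and "proper_param x2"
    and "proj_curve x1 \<noteq> proj_curve x2"
    and "affine E" and "aff_dim E = 2"
    and "proj_curve x2 \<subseteq> proj_closure E"
    and "\<not> (\<exists>F. affine F \<and> aff_dim F = 2 \<and>
               proj_curve x1 \<subseteq> proj_closure F \<and> proj_curve x2 \<subseteq> proj_closure F)"
    and "\<not> (\<exists>L. affine L \<and> aff_dim L = 1 \<and> proj_curve x1 = proj_closure L)"
    and "\<not> (\<exists>L. affine L \<and> aff_dim L = 1 \<and> proj_curve x2 = proj_closure L)"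
    and "a \<noteq> 0" and "complexify a \<notin> proj_closure E"
    and "projects_onto E a (proj_curve x1) (proj_curve x2)"
    and "rational_proj_point a"
    and "assoc_poly E a x1 x2 G"
  shows "\<exists>c. c \<noteq> 0 \<and> (\<forall>i j. coeff (coeff (smult [:c:] G) i) j \<in> \<rat>)"
proof -
  obtain \<psi> p q where \<psi>: "assoc_ratfun E a x1 x2 \<psi>" and q: "q \<noteq> 0" and cop: "coprime p q"
    and \<psi>_eq: "\<psi> = Fraction_Field.Fract p q" and G: "G = [:p, - q:]"
    using assms(14) unfolding assoc_poly_def by blast
  obtain l where l: "\<And>v. v \<in> proj_closure E \<Longrightarrow> lin l v = 0" "lin l (complexify a) \<noteq> 0"
    using plane_form_separating[OF assms(4,5,10,11)] by blast
  have l2: "lin l (homog (param_at x2 s)) = 0" if "s \<in> param_dom x2" for s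
    using lin_vanishes_on_param[OF _ that] l(1) assms(6) by blast
  obtain k where k: "k \<noteq> 0" "\<And>i. k * a $ i \<in> \<rat>"
    using assms(13) by (auto simp: rational_proj_point_def)
  have "\<forall>i. \<exists>r. k * a $ i = of_rat r" using k(2) by (blast elim: Rats_cases)
  from choice[OF this] obtain f where f: "\<forall>i. k * a $ i = of_rat (f i)" ..
  \<comment> \<open>The rational representative of the eye point, which supplies rational
    coefficients for the Cramer equations.\<close>
  define A :: "rat^4" where "A = (\<chi> i. f i)"
  have A: "of_rat_vec A = complex_of_real k *s complexify a"
    unfolding vec_eq_iff
  proof
    fix i
    have "complex_of_real (k * a $ i) = complex_of_real (of_rat (f i))" by (simp only: f[rule_format])
    then show "(of_rat_vec A :: complex^4) $ i = (complex_of_real k *s complexify a) $ i"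
      by (simp add: A_def complexify_def of_real_of_rat)
  qed
  have a_A: "complexify a = (1 / complex_of_real k) *s of_rat_vec A"
    unfolding A using k(1) by (simp add: vec_eq_iff)
  have lA: "lin l (of_rat_vec A) \<noteq> 0"
    unfolding A using l(2) k(1) lin_comb[of l "complex_of_real k" "complexify a" 0 0] by simp
  obtain S where S: "finite S" "inj_on (param_at x2 :: complex \<Rightarrow> _) (param_dom x2 - S)"
    using assms(2) by (auto simp: proper_param_def)
  obtain N where N: "N \<noteq> 0"
    "\<forall>b\<in>S. \<forall>F. F \<noteq> 0 \<longrightarrow> rat_poly_at F b = 0 \<longrightarrow> rat_poly_at N b = 0"
    using exists_poly_vanishing_on_algebraic[OF S(1)] by blast
  \<comment> \<open>All but finitely many \<open>t\<close> are good; the last conjunct makes the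
    value of \<psi> there equal to the quotient of \<open>p\<close> and \<open>q\<close>.\<close>
  define good where "good t \<longleftrightarrow> t \<in> param_dom x1 \<and> \<not> ratfun_pole of_real \<psi> t \<and>
       ratfun_eval of_real \<psi> t \<in> param_dom x2 \<and>
       projects_to E a (homog (param_at x1 t)) (homog (param_at x2 (ratfun_eval of_real \<psi> t))) \<and>
       real_poly_at q t \<noteq> 0" for t
  define B where "B = {t. \<not> good t}"
  have "finite {t. real_poly_at q t = 0}"
    using q by (intro poly_roots_finite) (simp add: map_poly_eq_0_iff)
  from finite_UnI[OF \<psi>[unfolded assoc_ratfun_def] this] have B: "finite B"
    by (rule rev_finite_subset) (auto simp: B_def good_def)
  have eval: "ratfun_eval of_real \<psi> t = real_poly_at p t / real_poly_at q t" if "good t" for t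
    using that ratfun_eval_Fract[OF q] unfolding good_def \<psi>_eq by blast
  \<comment> \<open>An infinite level set would send infinitely many points of the first curve to
    the one point with parameter \<nu>.\<close>
  have level: "finite {t. real_poly_at p t = \<nu> * real_poly_at q t}" for \<nu>
  proof (rule ccontr)
    assume inf: "infinite {t. real_poly_at p t = \<nu> * real_poly_at q t}"
    define T where "T = {t. real_poly_at p t = \<nu> * real_poly_at q t} - B"
    have good: "good t" and \<nu>: "ratfun_eval of_real \<psi> t = \<nu>" if "t \<in> T" for t
    proof -
      show g: "good t" using that by (simp add: T_def B_def)
      then show "ratfun_eval of_real \<psi> t = \<nu>"
        using that eval[OF g] by (simp add: T_def good_def)
    qed
    show False
    proof (rule projection_not_constant[OF assms(2,12) l])
      show "infinite T" using inf B by (simp add: T_def)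
      show "t \<in> param_dom x1" if "t \<in> T" for t using good[OF that] by (simp add: good_def)
      show "projects_to E a (homog (param_at x1 t)) (homog (param_at x2 \<nu>))" if "t \<in> T" for t
        using good[OF that] \<nu>[OF that] by (simp add: good_def)
    qed
  qed
  \<comment> \<open>The values of \<psi> to avoid: exceptional parameters of \<open>x2\<close> and
    roots of \<open>N\<close>. Finiteness of level sets keeps the set \<open>Z\<close> of bad
    arguments finite.\<close>
  define C where "C = S \<union> {s. rat_poly_at N s = 0}"
  have "finite {s :: complex. rat_poly_at N s = 0}" using N(1) by (intro poly_roots_finite) simp
  then have C: "finite C" using S(1) by (simp add: C_def)
  define Z where "Z = B \<union> (\<Union>\<nu>\<in>C. {t. real_poly_at p t = \<nu> * real_poly_at q t})"
  have Z: "finite Z" using B C level by (simp add: Z_def)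
  have rational: "poly q (of_rat t) \<noteq> 0 \<and> poly p (of_rat t) / poly q (of_rat t) \<in> \<rat>"
    if t: "of_rat t \<notin> Z" for t
  proof -
    let ?t = "of_rat t :: complex"
    have t_real: "?t = of_real (of_rat t)" by (simp add: of_real_of_rat)
    have g: "good ?t" using t by (simp add: Z_def B_def)
    define s where "s = ratfun_eval of_real \<psi> ?t"
    have s_eq: "s = real_poly_at p ?t / real_poly_at q ?t" using eval[OF g] by (simp add: s_def)
    have qt: "real_poly_at q ?t \<noteq> 0" using g by (simp add: good_def)
    \<comment> \<open>Thus \<open>t\<close> lies in the level set of \<open>s\<close>, which
      \<open>Z\<close> would contain if \<open>s\<close> were in \<open>C\<close>.\<close>
    have "real_poly_at p ?t = s * real_poly_at q ?t" using s_eq qt by simp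
    then have "s \<notin> C" using t by (auto simp: Z_def)
    have s_dom: "s \<in> param_dom x2" using g by (simp add: good_def s_def)
    obtain P where P: "homog (param_at x1 ?t) = (of_rat_vec P :: complex^4)"
      using param_at_of_rat by blast
    have proj: "projects_to E a (of_rat_vec P) (homog (param_at x2 s))"
      using g P by (simp add: good_def s_def)
    then obtain \<alpha> \<beta> where "homog (param_at x2 s) = \<alpha> *s complexify a + \<beta> *s of_rat_vec P"
      by (auto simp: projects_to_def)
    then have line: "homog (param_at x2 s) = (\<alpha> * (1 / complex_of_real k)) *s of_rat_vec A + \<beta> *s of_rat_vec P"
      unfolding a_A by (simp only: vector_smult_assoc)
    \<comment> \<open>The projected point differs from the eye point by definition of
      \<open>projects_to\<close>, so the two span a line.\<close>
    have "\<exists>i j. minor (of_rat_vec A :: complex^4) (of_rat_vec P) i j \<noteq> 0"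
    proof (rule exists_minor_nonzero)
      show "(of_rat_vec A :: complex^4) \<noteq> 0"
      proof
        assume z: "(of_rat_vec A :: complex^4) = 0"
        show False using lA unfolding z by simp
      qed
      show "(of_rat_vec P :: complex^4) \<noteq> 0" unfolding P[symmetric] by (rule homog_ne_0)
      show "of_rat_vec P \<noteq> c *s (of_rat_vec A :: complex^4)" if "c \<noteq> 0" for c
      proof
        assume "of_rat_vec P = c *s (of_rat_vec A :: complex^4)"
        then have "of_rat_vec P = (c * complex_of_real k) *s complexify a"
          unfolding A by (simp only: vector_smult_assoc)
        moreover have "c * complex_of_real k \<noteq> 0" using that k(1) by simp
        ultimately have "proj_eq (of_rat_vec P) (complexify a)" unfolding proj_eq_def by blast
        then show False using proj by (simp add: projects_to_def)
      qed
    qed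
    then obtain i j where ij: "minor (of_rat_vec A :: complex^4) (of_rat_vec P) i j \<noteq> 0" by blast
    have "\<exists>r. s = of_rat r"
    proof (rule rational_parameter_over_rational_line[OF S(2,1) _ l2 lA ij _ _ line])
      show "rat_poly_at N b = 0" if "b \<in> S" "F \<noteq> 0" "rat_poly_at F b = 0" for b F
        using N(2) that by blast
      show "s \<in> param_dom x2 - S" "rat_poly_at N s \<noteq> 0" using s_dom \<open>s \<notin> C\<close> by (simp_all add: C_def)
    qed
    then obtain r where r: "s = of_rat r" ..
    have "complex_of_real (poly p (of_rat t) / poly q (of_rat t)) = s"
      unfolding s_eq t_real real_poly_at_of_real by (rule of_real_divide)
    also have "\<dots> = complex_of_real (of_rat r)" by (simp add: r of_real_of_rat)
    finally have "complex_of_real (poly p (of_rat t) / poly q (of_rat t)) = complex_of_real (of_rat r)" .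
    then have "poly p (of_rat t) / poly q (of_rat t) = of_rat r" by (simp only: of_real_eq_iff)
    moreover have "poly q (of_rat t) \<noteq> 0" using qt unfolding t_real real_poly_at_of_real by auto
    ultimately show ?thesis by simp
  qed
  have "infinite {t::rat. poly q (of_rat t) \<noteq> 0 \<and> poly p (of_rat t) / poly q (of_rat t) \<in> \<rat>}"
  proof
    assume "finite {t::rat. poly q (of_rat t) \<noteq> 0 \<and> poly p (of_rat t) / poly q (of_rat t) \<in> \<rat>}"
    moreover have "finite (of_rat -` Z :: rat set)"
      using Z by (rule finite_vimageI) (simp add: inj_def)
    \<comment> \<open>Every rational outside the finite preimage of \<open>Z\<close> is an argument
      with a rational value.\<close>
    moreover have "UNIV = of_rat -` Z \<union> {t::rat. poly q (of_rat t) \<noteq> 0 \<and> poly p (of_rat t) / poly q (of_rat t) \<in> \<rat>}"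
      using rational by blast
    ultimately have "finite (UNIV :: rat set)" by (metis finite_UnI)
    then show False using infinite_UNIV_char_0 by blast
  qed
  then obtain c where c: "c \<noteq> 0" "\<And>j. c * coeff p j \<in> \<rat>" "\<And>j. c * coeff q j \<in> \<rat>"
    using rat_coeffs_if_rat_values[OF cop q] by blast
  have "coeff (coeff (smult [:c:] G) i) j \<in> \<rat>" for i j
    using c by (auto simp: G coeff_pCons split: nat.split)
  with c(1) show ?thesis by blast
qed

end
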